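(* Let $L$ be one of $\mathbf{IL}^-(\mathbf{J4})$, $\mathbf{IL}^-(\mathbf{J1},\mathbf{J4})$, $\mathbf{IL}^-(\mathbf{J4},\mathbf{J5})$, $\mathbf{IL}^-(\mathbf{J1},\mathbf{J4},\mathbf{J5})$, $\mathbf{IL}^-(\mathbf{J2})$, $\mathbf{IL}^-(\mathbf{J2},\mathbf{J4}_+)$. Then for every formula $A$ the following are equivalent: (1) $L\vdash A$; (2) $A$ is valid in every $\mathbf{ILS}$-frame in which all axioms of $L$ are valid; (3) $A$ is valid in every finite $\mathbf{ILS}$-frame in which all axioms of $L$ are valid.
   Context: Formulas are built from countably many propositional variables, $\top,\bot$, $\neg,\land,\lor,\to$, unary $\Box$ and binary $\rhd$; $\Diamond A$ abbreviates $\neg\Box\neg A$. The logic $\mathbf{IL}^-$ has as axioms all tautologies, $\Box(A\to B)\to(\Box A\to\Box B)$, $\Box(\Box A\to A)\to\Box A$, $(A\rhd C)\land(B\rhd C)\to(A\lor B)\rhd C$, and $\Box A\leftrightarrow(\neg A)\rhd\bot$; rules: modus ponens, necessitation, from $A\to B$ infer $C\rhd A\to C\rhd B$, from $A\to B$ infer $B\rhd C\to A\rhd C$. $\mathbf{IL}^-(\Sigma_1,\dots,\Sigma_n)$ is $\mathbf{IL}^-$ with schemata $\Sigma_i$ added as axioms. Schemata: $\mathbf{J1}$: $\Box(A\to B)\to A\rhd B$; $\mathbf{J2}$: $(A\rhd B)\land(B\rhd C)\to A\rhd C$; $\mathbf{J4}$: $A\rhd B\to(\Diamond A\to\Diamond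 B)$; $\mathbf{J4}_+$: $\Box(A\to B)\to(C\rhd A\to C\rhd B)$; $\mathbf{J5}$: $\Diamond A\rhd A$. An $\mathbf{ILS}$-frame is a triple $\langle W,R,\{S_x\}_{x\in W}\rangle$ with $W$ nonempty, $R$ transitive and conversely well-founded on $W$, each $S_x\subseteq W\times(\mathcal P(W)\setminus\{\emptyset\})$ such that $yS_xV$ implies $xRy$, and (monotonicity) $yS_xV$ and $V\subseteq U$ imply $yS_xU$. Satisfaction: usual Boolean clauses, $x\Vdash\Box A$ iff $y\Vdash A$ for all $y$ with $xRy$, and $x\Vdash A\rhd B$ iff for every $y$ with $xRy$ and $y\Vdash A$ there is $V\subseteq W$ with $yS_xV$ and $z\Vdash B$ for all $z\in V$. Validity in a frame: truth at every point under every satisfaction relation (for schemata: all instances). *)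

theory Defs imports Main begin

datatype fm =
    Var nat
  | Top ("\<^bold>\<top>")
  | Bot ("\<^bold>\<bottom>")
  | Neg fm ("\<^bold>\<not> _" [70] 70)
  | Con fm fm (infixr "\<^bold>\<and>" 62)
  | Dis fm fm (infixr "\<^bold>\<or>" 61)
  | Imp fm fm (infixr "\<^bold>\<rightarrow>" 55)
  | Box fm ("\<^bold>\<box> _" [70] 70)
  | Rhd fm fm (infix "\<^bold>\<rhd>" 65)

abbreviation Dia :: "fm \<Rightarrow> fm" ("\<^bold>\<diamond> _" [70] 70) where
  "\<^bold>\<diamond> A \<equiv> \<^bold>\<not> \<^bold>\<box> \<^bold>\<not> A"

abbreviation Iff :: "fm \<Rightarrow> fm \<Rightarrow> fm" (infix "\<^bold>\<leftrightarrow>" 54) where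
  "A \<^bold>\<leftrightarrow> B \<equiv> (A \<^bold>\<rightarrow> B) \<^bold>\<and> (B \<^bold>\<rightarrow> A)"

text \<open>Tautologies are formulas of the full modal language that hold under every Boolean
  evaluation in which variables and formulas with outermost symbol \<open>\<^bold>\<box>\<close> or \<open>\<^bold>\<rhd>\<close>
  are treated as atoms; \<open>v\<close> is only ever consulted on such formulas.\<close>

primrec beval :: "(fm \<Rightarrow> bool) \<Rightarrow> fm \<Rightarrow> bool" where
  "beval v (Var n) = v (Var n)"
| "beval v \<^bold>\<top> = True"
| "beval v \<^bold>\<bottom> = False"
| "beval v (\<^bold>\<not> A) = (\<not> beval v A)"
| "beval v (A \<^bold>\<and> B) = (beval v A \<and> beval v B)"
| "beval v (A \<^bold>\<or> B) = (beval v A \<or> beval v B)"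
| "beval v (A \<^bold>\<rightarrow> B) = (beval v A \<longrightarrow> beval v B)"
| "beval v (\<^bold>\<box> A) = v (\<^bold>\<box> A)"
| "beval v (A \<^bold>\<rhd> B) = v (A \<^bold>\<rhd> B)"

definition tautology :: "fm \<Rightarrow> bool" where
  "tautology A \<longleftrightarrow> (\<forall>v. beval v A)"

text \<open>A schema is the set of all its instances.\<close>

definition J1 :: "fm set" where
  "J1 = {\<^bold>\<box> (A \<^bold>\<rightarrow> B) \<^bold>\<rightarrow> A \<^bold>\<rhd> B | A B. True}"

definition J2 :: "fm set" where
  "J2 = {(A \<^bold>\<rhd> B) \<^bold>\<and> (B \<^bold>\<rhd> C) \<^bold>\<rightarrow> A \<^bold>\<rhd> C | A B C. True}"

definition J4 :: "fm set" where
  "J4 = {A \<^bold>\<rhd> B \<^bold>\<rightarrow> (\<^bold>\<diamond> A \<^bold>\<rightarrow> \<^bold>\<diamond> B) | A B. True}"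

definition J4p :: "fm set" ("J4\<^sub>+") where
  "J4\<^sub>+ = {\<^bold>\<box> (A \<^bold>\<rightarrow> B) \<^bold>\<rightarrow> (C \<^bold>\<rhd> A \<^bold>\<rightarrow> C \<^bold>\<rhd> B) | A B C. True}"

definition J5 :: "fm set" where
  "J5 = {\<^bold>\<diamond> A \<^bold>\<rhd> A | A. True}"

definition IL_minus_axioms :: "fm set" where
  "IL_minus_axioms =
     {A. tautology A}
   \<union> {\<^bold>\<box> (A \<^bold>\<rightarrow> B) \<^bold>\<rightarrow> (\<^bold>\<box> A \<^bold>\<rightarrow> \<^bold>\<box> B) | A B. True}
   \<union> {\<^bold>\<box> (\<^bold>\<box> A \<^bold>\<rightarrow> A) \<^bold>\<rightarrow> \<^bold>\<box> A | A. True}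
   \<union> {(A \<^bold>\<rhd> C) \<^bold>\<and> (B \<^bold>\<rhd> C) \<^bold>\<rightarrow> (A \<^bold>\<or> B) \<^bold>\<rhd> C | A B C. True}
   \<union> {\<^bold>\<box> A \<^bold>\<leftrightarrow> (\<^bold>\<not> A) \<^bold>\<rhd> \<^bold>\<bottom> | A. True}"

text \<open>The logic \<open>IL\<^sup>-(\<Sigma>\<^sub>1, \<dots>, \<Sigma>\<^sub>n)\<close> is represented by the union
  \<open>\<Sigma> = \<Sigma>\<^sub>1 \<union> \<dots> \<union> \<Sigma>\<^sub>n\<close> of the added schemata.\<close>

definition logic_axioms :: "fm set \<Rightarrow> fm set" where
  "logic_axioms \<Sigma> = IL_minus_axioms \<union> \<Sigma>"

inductive IL_minus_derives :: "fm set \<Rightarrow> fm \<Rightarrow> bool" ("IL\<^sup>-'(_') \<turnstile> _" [0, 50] 50)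
  for \<Sigma> :: "fm set" where
  ax: "A \<in> logic_axioms \<Sigma> \<Longrightarrow> IL\<^sup>-(\<Sigma>) \<turnstile> A"
| mp: "IL\<^sup>-(\<Sigma>) \<turnstile> A \<^bold>\<rightarrow> B \<Longrightarrow> IL\<^sup>-(\<Sigma>) \<turnstile> A \<Longrightarrow> IL\<^sup>-(\<Sigma>) \<turnstile> B"
| nec: "IL\<^sup>-(\<Sigma>) \<turnstile> A \<Longrightarrow> IL\<^sup>-(\<Sigma>) \<turnstile> \<^bold>\<box> A"
| R1: "IL\<^sup>-(\<Sigma>) \<turnstile> A \<^bold>\<rightarrow> B \<Longrightarrow> IL\<^sup>-(\<Sigma>) \<turnstile> C \<^bold>\<rhd> A \<^bold>\<rightarrow> C \<^bold>\<rhd> B"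
| R2: "IL\<^sup>-(\<Sigma>) \<turnstile> A \<^bold>\<rightarrow> B \<Longrightarrow> IL\<^sup>-(\<Sigma>) \<turnstile> B \<^bold>\<rhd> C \<^bold>\<rightarrow> A \<^bold>\<rhd> C"

text \<open>Frames are carried by a set of worlds inside a type \<open>'w\<close>. HOL cannot quantify over types
  within a formula, so the class of all frames is represented by the frames over an arbitrary infinite
  type: every finite frame, and any frame of the cardinality of \<open>'w\<close> or less, has an isomorphic copy there.

  \<open>(y, V) \<in> intp F x\<close> stands for \<open>y S\<^sub>x V\<close>. The family \<open>S\<close> is indexed by the worlds, so
  \<open>intp F x\<close> is irrelevant when \<open>x\<close> is not a world.\<close>

record 'w frame =
  worlds :: "'w set"
  acc :: "('w \<times> 'w) set"
  intp :: "'w \<Rightarrow> ('w \<times> 'w set) set"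

definition ILS_frame :: "'w frame \<Rightarrow> bool" where
  "ILS_frame F \<longleftrightarrow>
     worlds F \<noteq> {} \<and>
     acc F \<subseteq> worlds F \<times> worlds F \<and> trans (acc F) \<and> wf ((acc F)\<inverse>) \<and>
     (\<forall>x \<in> worlds F.
        intp F x \<subseteq> worlds F \<times> (Pow (worlds F) - {{}}) \<and>
        (\<forall>y V. (y, V) \<in> intp F x \<longrightarrow> (x, y) \<in> acc F) \<and>
        (\<forall>y V U. (y, V) \<in> intp F x \<and> V \<subseteq> U \<and> U \<subseteq> worlds F \<longrightarrow> (y, U) \<in> intp F x))"

text \<open>A satisfaction relation on a frame is determined by a valuation \<open>v\<close> of the variables;
  its values at points that are not worlds play no role in validity.\<close>

primrec sat :: "'w frame \<Rightarrow> ('w \<Rightarrow> nat \<Rightarrow> bool) \<Rightarrow> 'w \<Rightarrow> fm \<Rightarrow> bool" where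
  "sat F v x (Var n) = v x n"
| "sat F v x \<^bold>\<top> = True"
| "sat F v x \<^bold>\<bottom> = False"
| "sat F v x (\<^bold>\<not> A) = (\<not> sat F v x A)"
| "sat F v x (A \<^bold>\<and> B) = (sat F v x A \<and> sat F v x B)"
| "sat F v x (A \<^bold>\<or> B) = (sat F v x A \<or> sat F v x B)"
| "sat F v x (A \<^bold>\<rightarrow> B) = (sat F v x A \<longrightarrow> sat F v x B)"
| "sat F v x (\<^bold>\<box> A) = (\<forall>y. (x, y) \<in> acc F \<longrightarrow> sat F v y A)"
| "sat F v x (A \<^bold>\<rhd> B) = (\<forall>y. (x, y) \<in> acc F \<and> sat F v y A \<longrightarrow>
      (\<exists>V. V \<subseteq> worlds F \<and> (y, V) \<in> intp F x \<and> (\<forall>z \<in> V. sat F v z B)))"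

definition valid :: "'w frame \<Rightarrow> fm \<Rightarrow> bool" (infix "\<Turnstile>" 50) where
  "F \<Turnstile> A \<longleftrightarrow> (\<forall>v. \<forall>x \<in> worlds F. sat F v x A)"

definition frame_for :: "fm set \<Rightarrow> 'w frame \<Rightarrow> bool" where
  "frame_for \<Sigma> F \<longleftrightarrow> ILS_frame F \<and> (\<forall>B \<in> logic_axioms \<Sigma>. F \<Turnstile> B)"

end

theory Submission imports Defs begin

text \<open>Maximal consistent sets are handled as Boolean valuations satisfying all theorems, so that
  propositional reasoning inside them is evaluation. The countermodel has finitely many of them,
  one for each behaviour on a finite set of relevant formulas, with the usual accessibility relation
  for provability logic. Since \<open>S\<^sub>x\<close> relates worlds to sets, it can be read off syntactically:
  \<open>y S\<^sub>x V\<close> holds if some \<open>C \<rhd> D\<close> is true at \<open>x\<close> with \<open>C\<close> true at \<open>y\<close> and \<open>V\<close> containing all worlds where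
  \<open>D\<close> is true (under \<open>J4\<^sub>+\<close>: all such worlds above \<open>x\<close>); \<open>J1\<close> adds the case \<open>y \<in> V\<close> and \<open>J5\<close> the case
  that \<open>V\<close> meets the successors of \<open>y\<close>. No copies of worlds are needed. Letting \<open>D\<close> range over finite
  disjunctions of subformulas makes the unions of sets required by \<open>J2\<close> definable.\<close>

section \<open>Maximal consistent sets as Boolean valuations\<close>

definition canon :: "fm set \<Rightarrow> (fm \<Rightarrow> bool) \<Rightarrow> bool" where
  "canon \<Sigma> v \<longleftrightarrow> (\<forall>A. (IL\<^sup>-(\<Sigma>) \<turnstile> A) \<longrightarrow> beval v A)"

lemma derives_tautology: "(\<And>v. beval v A) \<Longrightarrow> IL\<^sup>-(\<Sigma>) \<turnstile> A"
  by (rule ax) (simp add: logic_axioms_def IL_minus_axioms_def tautology_def)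

text \<open>Zorn's lemma gives a theory maximal among those containing \<open>M\<close> and omitting
  \<open>A\<close>; it decides every formula. \<open>M\<close> is arbitrary because the formulas
  boxed at a valuation are extended later in the same way.\<close>

lemma lindenbaum:
  assumes thms: "\<And>B. IL\<^sup>-(\<Sigma>) \<turnstile> B \<Longrightarrow> B \<in> M"
    and mp: "\<And>B C. B \<^bold>\<rightarrow> C \<in> M \<Longrightarrow> B \<in> M \<Longrightarrow> C \<in> M"
    and A: "A \<notin> M"
  obtains v where "canon \<Sigma> v" "\<And>B. B \<in> M \<Longrightarrow> beval v B" "\<not> beval v A"
proof -
  define \<T> where "\<T> = {N. M \<subseteq> N \<and> (\<forall>B C. B \<^bold>\<rightarrow> C \<in> N \<longrightarrow> B \<in> N \<longrightarrow> C \<in> N) \<and> A \<notin> N}"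
  have "\<exists>N\<in>\<T>. \<forall>X\<in>\<T>. N \<subseteq> X \<longrightarrow> X = N"
  proof (rule subset_Zorn_nonempty)
    show "\<T> \<noteq> {}" using mp A unfolding \<T>_def by blast
  next
    fix \<C> assume ne: "\<C> \<noteq> {}" and ch: "subset.chain \<T> \<C>"
    have sub: "\<C> \<subseteq> \<T>" and tot: "\<And>X Y. X \<in> \<C> \<Longrightarrow> Y \<in> \<C> \<Longrightarrow> X \<subseteq> Y \<or> Y \<subseteq> X"
      using ch by (auto simp: subset_chain_def)
    have "C \<in> \<Union>\<C>" if BC: "B \<^bold>\<rightarrow> C \<in> \<Union>\<C>" "B \<in> \<Union>\<C>" for B C
    proof -
      obtain X Y where XY: "X \<in> \<C>" "Y \<in> \<C>" "B \<^bold>\<rightarrow> C \<in> X" "B \<in> Y" using BC by blast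
      then obtain Z where "Z \<in> \<C>" "B \<^bold>\<rightarrow> C \<in> Z" "B \<in> Z" using tot by blast
      then show ?thesis using sub unfolding \<T>_def by blast
    qed
    then show "\<Union>\<C> \<in> \<T>" using ne sub unfolding \<T>_def by blast
  qed
  then obtain N where N: "N \<in> \<T>" and max: "\<And>X. X \<in> \<T> \<Longrightarrow> N \<subseteq> X \<Longrightarrow> X = N" by blast
  have MN: "M \<subseteq> N" and mpN: "\<And>B C. B \<^bold>\<rightarrow> C \<in> N \<Longrightarrow> B \<in> N \<Longrightarrow> C \<in> N" and AN: "A \<notin> N"
    using N unfolding \<T>_def by blast+
  have taut: "B \<in> N" if "\<And>v. beval v B" for B
    using derives_tautology[OF that] thms MN by blast
  have mp2: "D \<in> N" if "B \<in> N" "C \<in> N" "\<And>v. beval v B \<Longrightarrow> beval v C \<Longrightarrow> beval v D" for B C D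
  proof -
    have "B \<^bold>\<rightarrow> (C \<^bold>\<rightarrow> D) \<in> N" by (rule taut) (simp add: that)
    then show ?thesis using mpN that by blast
  qed
  have mp1: "D \<in> N" if "B \<in> N" "\<And>v. beval v B \<Longrightarrow> beval v D" for B D
    using mp2[of B B D] that by blast
  \<comment> \<open>The set \<open>?X\<close> below is the theory generated by \<open>N\<close> and
    \<open>B\<close>. If it omitted \<open>A\<close>, maximality would put \<open>B\<close> into
    \<open>N\<close>. From here on \<open>A\<close> acts as falsum for \<open>N\<close>.\<close>
  have ex: "B \<^bold>\<rightarrow> A \<in> N" if "B \<notin> N" for B
  proof (rule ccontr)
    assume "B \<^bold>\<rightarrow> A \<notin> N"
    let ?X = "{C. B \<^bold>\<rightarrow> C \<in> N}"
    have "N \<subseteq> ?X" by (auto intro: mp1)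
    moreover have "?X \<in> \<T>"
      using MN \<open>N \<subseteq> ?X\<close> \<open>B \<^bold>\<rightarrow> A \<notin> N\<close> unfolding \<T>_def
      by (auto intro: mp2[of "B \<^bold>\<rightarrow> (C \<^bold>\<rightarrow> D)" "B \<^bold>\<rightarrow> C" "B \<^bold>\<rightarrow> D" for C D])
    ultimately have "?X = N" by (rule max[rotated])
    moreover have "B \<in> ?X" by (auto intro: taut)
    ultimately show False using that by blast
  qed
  define v where "v = (\<lambda>B. B \<in> N)"
  have truth: "beval v B \<longleftrightarrow> B \<in> N" for B
  proof (induction B)
    case (Neg B)
    have "\<not> (B \<in> N \<and> \<^bold>\<not> B \<in> N)" using mp2[of B "\<^bold>\<not> B" A] AN by auto
    moreover have "B \<in> N \<or> \<^bold>\<not> B \<in> N"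
      using ex[of B] ex[of "\<^bold>\<not> B"] mp2[of "B \<^bold>\<rightarrow> A" "\<^bold>\<not> B \<^bold>\<rightarrow> A" A] AN by auto
    ultimately show ?case using Neg by auto
  next
    case (Con B C)
    then show ?case
      using mp1[of "B \<^bold>\<and> C" B] mp1[of "B \<^bold>\<and> C" C] mp2[of B C "B \<^bold>\<and> C"] by auto
  next
    case (Dis B C)
    have "B \<in> N \<or> C \<in> N" if "B \<^bold>\<or> C \<in> N"
    proof (rule ccontr)
      assume "\<not> ?thesis"
      then have "B \<^bold>\<rightarrow> A \<in> N" "C \<^bold>\<rightarrow> A \<in> N" using ex by blast+
      then have "B \<^bold>\<or> C \<^bold>\<rightarrow> A \<in> N" by (rule mp2) auto
      then show False using that mpN AN by blast
    qed
    then show ?case using Dis mp1[of B "B \<^bold>\<or> C"] mp1[of C "B \<^bold>\<or> C"] by auto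
  next
    case (Imp B C)
    have "B \<^bold>\<rightarrow> C \<in> N" if "B \<notin> N"
    proof (rule ccontr)
      assume "B \<^bold>\<rightarrow> C \<notin> N"
      from ex[OF this] ex[OF that] have "A \<in> N" by (rule mp2) auto
      then show False using AN by blast
    qed
    then show ?case using Imp mp1[of C "B \<^bold>\<rightarrow> C"] mpN[of B C] by auto
  next
    case Bot
    show ?case using mp1[of "\<^bold>\<bottom>" A] AN by auto
  qed (auto simp: v_def intro: taut)
  show ?thesis
  proof (rule that)
    show "canon \<Sigma> v" using thms MN truth unfolding canon_def by blast
    show "beval v B" if "B \<in> M" for B using that MN truth by blast
    show "\<not> beval v A" using truth AN by blast
  qed
qed

text \<open>Lindenbaum's lemma for the set of theorems. It replaces formal derivations by evaluation
  in all canonical valuations.\<close>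

lemma derivesI: "(\<And>v. canon \<Sigma> v \<Longrightarrow> beval v A) \<Longrightarrow> IL\<^sup>-(\<Sigma>) \<turnstile> A"
  by (rule ccontr, rule lindenbaum[of \<Sigma> "{B. IL\<^sup>-(\<Sigma>) \<turnstile> B}" A]) (auto intro: mp)

section \<open>Modal laws inside canonical valuations\<close>

lemma canon_ax: "canon \<Sigma> v \<Longrightarrow> A \<in> logic_axioms \<Sigma> \<Longrightarrow> beval v A"
  unfolding canon_def by (blast intro: ax)

lemma canon_K: "canon \<Sigma> v \<Longrightarrow> v (\<^bold>\<box> (A \<^bold>\<rightarrow> B)) \<Longrightarrow> v (\<^bold>\<box> A) \<Longrightarrow> v (\<^bold>\<box> B)"
  using canon_ax[of \<Sigma> v "\<^bold>\<box> (A \<^bold>\<rightarrow> B) \<^bold>\<rightarrow> (\<^bold>\<box> A \<^bold>\<rightarrow> \<^bold>\<box> B)"]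
  by (simp add: logic_axioms_def IL_minus_axioms_def)

lemma canon_Loeb: "canon \<Sigma> v \<Longrightarrow> v (\<^bold>\<box> (\<^bold>\<box> A \<^bold>\<rightarrow> A)) \<Longrightarrow> v (\<^bold>\<box> A)"
  using canon_ax[of \<Sigma> v "\<^bold>\<box> (\<^bold>\<box> A \<^bold>\<rightarrow> A) \<^bold>\<rightarrow> \<^bold>\<box> A"]
  by (simp add: logic_axioms_def IL_minus_axioms_def)

lemma canon_J3: "canon \<Sigma> v \<Longrightarrow> v (A \<^bold>\<rhd> C) \<Longrightarrow> v (B \<^bold>\<rhd> C) \<Longrightarrow> v ((A \<^bold>\<or> B) \<^bold>\<rhd> C)"
  using canon_ax[of \<Sigma> v "(A \<^bold>\<rhd> C) \<^bold>\<and> (B \<^bold>\<rhd> C) \<^bold>\<rightarrow> (A \<^bold>\<or> B) \<^bold>\<rhd> C"]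
  by (simp add: logic_axioms_def IL_minus_axioms_def)

lemma canon_J6: "canon \<Sigma> v \<Longrightarrow> v (\<^bold>\<box> A) \<longleftrightarrow> v ((\<^bold>\<not> A) \<^bold>\<rhd> \<^bold>\<bottom>)"
  using canon_ax[of \<Sigma> v "\<^bold>\<box> A \<^bold>\<leftrightarrow> (\<^bold>\<not> A) \<^bold>\<rhd> \<^bold>\<bottom>"]
  by (auto simp: logic_axioms_def IL_minus_axioms_def)

lemma canon_nec: "canon \<Sigma> v \<Longrightarrow> (\<And>u. canon \<Sigma> u \<Longrightarrow> beval u A) \<Longrightarrow> v (\<^bold>\<box> A)"
  using nec[OF derivesI, of \<Sigma> A] by (fastforce simp: canon_def)

lemma canon_box_mono:
  "canon \<Sigma> v \<Longrightarrow> v (\<^bold>\<box> A) \<Longrightarrow> (\<And>u. canon \<Sigma> u \<Longrightarrow> beval u A \<Longrightarrow> beval u B) \<Longrightarrow> v (\<^bold>\<box> B)"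
  by (rule canon_K, assumption, rule canon_nec) auto

lemma canon_R1:
  "canon \<Sigma> v \<Longrightarrow> v (C \<^bold>\<rhd> A) \<Longrightarrow> (\<And>u. canon \<Sigma> u \<Longrightarrow> beval u A \<Longrightarrow> beval u B) \<Longrightarrow> v (C \<^bold>\<rhd> B)"
  using R1[OF derivesI, of \<Sigma> A B C] by (fastforce simp: canon_def)

lemma canon_R2:
  "canon \<Sigma> v \<Longrightarrow> v (B \<^bold>\<rhd> C) \<Longrightarrow> (\<And>u. canon \<Sigma> u \<Longrightarrow> beval u A \<Longrightarrow> beval u B) \<Longrightarrow> v (A \<^bold>\<rhd> C)"
  using R2[OF derivesI, of \<Sigma> A B C] by (fastforce simp: canon_def)

text \<open>The axiom linking \<open>\<box>\<close> and \<open>\<rhd>\<close>, taken at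
  \<open>\<not> A\<close>; the rule for antecedents removes the double negation.\<close>

lemma canon_rhd_bot: "canon \<Sigma> v \<Longrightarrow> v (A \<^bold>\<rhd> \<^bold>\<bottom>) \<longleftrightarrow> v (\<^bold>\<box> \<^bold>\<not> A)"
  using canon_J6[of \<Sigma> v "\<^bold>\<not> A"]
    canon_R2[of \<Sigma> v A "\<^bold>\<bottom>" "\<^bold>\<not> \<^bold>\<not> A"] canon_R2[of \<Sigma> v "\<^bold>\<not> \<^bold>\<not> A" "\<^bold>\<bottom>" A]
  by (metis beval.simps(4))

lemma canon_rhd_impossible: "canon \<Sigma> v \<Longrightarrow> v (\<^bold>\<box> \<^bold>\<not> A) \<Longrightarrow> v (A \<^bold>\<rhd> B)"
  using canon_rhd_bot[of \<Sigma> v A] canon_R1[of \<Sigma> v A "\<^bold>\<bottom>" B] by auto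

text \<open>The standard derivation of transitivity from Loeb's axiom, applied to \<open>A \<and> \<box>A\<close>.\<close>

lemma canon_4:
  assumes v: "canon \<Sigma> v" and A: "v (\<^bold>\<box> A)"
  shows "v (\<^bold>\<box> \<^bold>\<box> A)"
proof -
  let ?B = "A \<^bold>\<and> \<^bold>\<box> A"
  have "u (\<^bold>\<box> A)" if "canon \<Sigma> u" "u (\<^bold>\<box> ?B)" for u
    using canon_box_mono[OF that] by simp
  then have "v (\<^bold>\<box> (\<^bold>\<box> ?B \<^bold>\<rightarrow> ?B))"
    by (intro canon_box_mono[OF v A]) auto
  then have "v (\<^bold>\<box> ?B)" by (rule canon_Loeb[OF v])
  then show ?thesis by (rule canon_box_mono[OF v]) simp
qed

text \<open>By Loeb's axiom, \<open>\<box> A \<rightarrow> A\<close> lies outside the theory of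
  formulas boxed at \<open>v\<close>, so Lindenbaum's lemma can refute it there. That
  \<open>u\<close> gains \<open>\<box> A\<close> will make accessibility strict.\<close>

lemma canon_box_witness:
  assumes v: "canon \<Sigma> v" and A: "\<not> v (\<^bold>\<box> A)"
  obtains u where "canon \<Sigma> u" "\<And>D. v (\<^bold>\<box> D) \<Longrightarrow> beval u D \<and> u (\<^bold>\<box> D)"
    "\<not> beval u A" "u (\<^bold>\<box> A)"
proof -
  have "\<^bold>\<box> A \<^bold>\<rightarrow> A \<notin> {B. v (\<^bold>\<box> B)}"
    using canon_Loeb[OF v, of A] A by auto
  from lindenbaum[of \<Sigma> "{B. v (\<^bold>\<box> B)}", OF _ _ this]
  obtain u where u: "canon \<Sigma> u" "\<And>B. v (\<^bold>\<box> B) \<Longrightarrow> beval u B" "\<not> beval u (\<^bold>\<box> A \<^bold>\<rightarrow> A)"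
    using canon_nec[OF v] canon_K[OF v] unfolding canon_def by (metis mem_Collect_eq)
  show ?thesis
    by (rule that[of u]) (use u u(2)[OF canon_4[OF v]] in auto)
qed

section \<open>Finite disjunctions\<close>

text \<open>The order of the disjuncts is arbitrary: formulas enter the arguments only up to Boolean
  equivalence.\<close>

definition disj :: "fm set \<Rightarrow> fm" where
  "disj S = foldr Dis (SOME xs. set xs = S) \<^bold>\<bottom>"

lemma beval_disj: "finite S \<Longrightarrow> beval v (disj S) \<longleftrightarrow> (\<exists>B\<in>S. beval v B)"
proof -
  assume "finite S"
  then have *: "set (SOME xs. set xs = S) = S"
    by (rule someI_ex[OF finite_list])
  have "beval v (foldr Dis xs \<^bold>\<bottom>) \<longleftrightarrow> (\<exists>B\<in>set xs. beval v B)" for xs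
    by (induction xs) auto
  from this[of "SOME xs. set xs = S"] show ?thesis unfolding disj_def * .
qed

text \<open>Induction with the disjunction axiom; the empty disjunction is impossible and hence
  related to every \<open>C\<close>.\<close>

lemma canon_disj_rhd:
  assumes v: "canon \<Sigma> v" and "finite S" and "\<And>B. B \<in> S \<Longrightarrow> v (B \<^bold>\<rhd> C)"
  shows "v (disj S \<^bold>\<rhd> C)"
  using assms(2,3)
proof (induction S rule: finite_induct)
  case empty
  have "v (\<^bold>\<box> \<^bold>\<not> disj {})" by (rule canon_nec[OF v]) (simp add: beval_disj)
  then show ?case by (rule canon_rhd_impossible[OF v])
next
  case (insert B S)
  then have "v ((B \<^bold>\<or> disj S) \<^bold>\<rhd> C)" by (intro canon_J3[OF v]) auto
  then show ?case by (rule canon_R2[OF v]) (use insert in \<open>simp add: beval_disj\<close>)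
qed

text \<open>\<open>A\<close> implies \<open>(A \<and> \<not> B) \<or> B\<close>, whose first
  disjunct is impossible by the box and so related to everything.\<close>

lemma canon_rhd_local:
  assumes v: "canon \<Sigma> v" and "v (\<^bold>\<box> \<^bold>\<not> (A \<^bold>\<and> \<^bold>\<not> B))" "v (B \<^bold>\<rhd> C)"
  shows "v (A \<^bold>\<rhd> C)"
  using canon_J3[OF v canon_rhd_impossible[OF v assms(2)] assms(3)]
  by (rule canon_R2[OF v]) auto

section \<open>Finite sets of relevant formulas\<close>

primrec subfms :: "fm \<Rightarrow> fm set" where
  "subfms (Var n) = {Var n}"
| "subfms \<^bold>\<top> = {\<^bold>\<top>}"
| "subfms \<^bold>\<bottom> = {\<^bold>\<bottom>}"
| "subfms (\<^bold>\<not> A) = insert (\<^bold>\<not> A) (subfms A)"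
| "subfms (A \<^bold>\<and> B) = insert (A \<^bold>\<and> B) (subfms A \<union> subfms B)"
| "subfms (A \<^bold>\<or> B) = insert (A \<^bold>\<or> B) (subfms A \<union> subfms B)"
| "subfms (A \<^bold>\<rightarrow> B) = insert (A \<^bold>\<rightarrow> B) (subfms A \<union> subfms B)"
| "subfms (\<^bold>\<box> A) = insert (\<^bold>\<box> A) (subfms A)"
| "subfms (A \<^bold>\<rhd> B) = insert (A \<^bold>\<rhd> B) (subfms A \<union> subfms B)"

lemma finite_subfms: "finite (subfms A)" by (induction A) auto

lemma subfms_self: "A \<in> subfms A" by (cases A) auto

lemma subfms_trans: "B \<in> subfms A \<Longrightarrow> subfms B \<subseteq> subfms A" by (induction A) auto

text \<open>The diamonds serve \<open>J5\<close>: a successor critical for \<open>B\<close> must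
  falsify \<open>\<diamond> B\<close> too.\<close>

definition antecedents :: "fm \<Rightarrow> fm set" where
  "antecedents A = subfms A \<union> {\<^bold>\<diamond> B | B. B \<in> subfms A}"

text \<open>Accessibility in the canonical model only respects boxes of these formulas. The last
  component makes criticality expressible: see \<open>rhd_witness\<close> below.\<close>

definition box_bodies :: "fm \<Rightarrow> fm set" where
  "box_bodies A = {D. \<^bold>\<box> D \<in> subfms A} \<union> Neg ` (antecedents A \<union> disj ` Pow (subfms A))
    \<union> (\<lambda>(B, T). \<^bold>\<not> (B \<^bold>\<and> \<^bold>\<not> disj T)) ` ((subfms A \<union> disj ` Pow (subfms A)) \<times> Pow (antecedents A))"

text \<open>Box bodies occur with and without their box, so agreement here preserves everything
  accessibility compares.\<close>

definition relevant :: "fm \<Rightarrow> fm set" where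
  "relevant A = antecedents A \<union> box_bodies A \<union> Box ` box_bodies A"

lemma subfms_relevant: "subfms A \<subseteq> relevant A"
  by (auto simp: relevant_def antecedents_def)

lemma finite_antecedents: "finite (antecedents A)"
proof -
  have "{\<^bold>\<diamond> B | B. B \<in> subfms A} = (\<lambda>B. \<^bold>\<diamond> B) ` subfms A" by auto
  then show ?thesis by (simp add: antecedents_def finite_subfms)
qed

lemma finite_relevant: "finite (relevant A)"
proof -
  have "{D. \<^bold>\<box> D \<in> subfms A} = Box -` subfms A" by auto
  then have "finite {D. \<^bold>\<box> D \<in> subfms A}" by (simp add: finite_subfms finite_vimageI inj_def)
  then show ?thesis
    by (simp add: relevant_def box_bodies_def finite_subfms finite_antecedents)
qed

section \<open>The finite canonical model\<close>

text \<open>The worlds are points of the given type labelled by canonical valuations, so that no frame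
  has to be transported. The flags say which optional clauses enter the relations \<open>S\<^sub>x\<close>.\<close>

locale canonical_model =
  fixes \<Sigma> :: "fm set" and j1 j5 j4p :: bool and A\<^sub>0 :: fm and W :: "'w set" and g :: "'w \<Rightarrow> fm \<Rightarrow> bool"
  assumes ax_J1: "j1 \<Longrightarrow> J1 \<subseteq> \<Sigma>"
    and ax_J5: "j5 \<Longrightarrow> J5 \<subseteq> \<Sigma>"
    and ax_J4p: "j4p \<Longrightarrow> J4\<^sub>+ \<subseteq> \<Sigma>"
    and underivable: "\<not> (IL\<^sup>-(\<Sigma>) \<turnstile> A\<^sub>0)"
    and canon_J4: "\<And>v A B. canon \<Sigma> v \<Longrightarrow> v (A \<^bold>\<rhd> B) \<Longrightarrow> v (\<^bold>\<box> \<^bold>\<not> B) \<Longrightarrow> v (\<^bold>\<box> \<^bold>\<not> A)"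
    and finite_W: "finite W"
    and canon_g: "\<And>x. x \<in> W \<Longrightarrow> canon \<Sigma> (g x)"
    and dense_g: "\<And>v. canon \<Sigma> v \<Longrightarrow> \<exists>x\<in>W. \<forall>B\<in>relevant A\<^sub>0. beval (g x) B \<longleftrightarrow> beval v B"
begin

abbreviation \<Phi> where "\<Phi> \<equiv> subfms A\<^sub>0"
abbreviation ants where "ants \<equiv> antecedents A\<^sub>0"
abbreviation boxed where "boxed \<equiv> box_bodies A\<^sub>0"

abbreviation holds :: "'w \<Rightarrow> fm \<Rightarrow> bool" where "holds x B \<equiv> beval (g x) B"

text \<open>The existential clause demands a newly true box, which makes the relation irreflexive,
  as usual for Loeb's axiom.\<close>

definition R :: "('w \<times> 'w) set" where
  "R = {(x, y). x \<in> W \<and> y \<in> W \<and> (\<forall>D\<in>boxed. g x (\<^bold>\<box> D) \<longrightarrow> holds y D \<and> g y (\<^bold>\<box> D)) \<and>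
     (\<exists>D\<in>boxed. g y (\<^bold>\<box> D) \<and> \<not> g x (\<^bold>\<box> D))}"

definition ext :: "'w \<Rightarrow> fm \<Rightarrow> 'w set" where
  "ext x B = {z \<in> W. holds z B \<and> (j4p \<longrightarrow> (x, z) \<in> R)}"

definition N :: "'w \<Rightarrow> ('w \<times> 'w set) set" where
  "N x = {(y, V). (x, y) \<in> R \<and> V \<subseteq> W \<and>
     ((\<exists>C\<in>ants. \<exists>S\<subseteq>\<Phi>. g x (C \<^bold>\<rhd> disj S) \<and> holds y C \<and> ext x (disj S) \<subseteq> V)
      \<or> (j1 \<and> y \<in> V) \<or> (j5 \<and> V \<inter> R `` {y} \<noteq> {}))}"

definition M :: "'w frame" where
  "M = \<lparr>worlds = W, acc = R, intp = N\<rparr>"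

lemma M_simps [simp]: "worlds M = W" "acc M = R" "intp M = N"
  by (simp_all add: M_def)

lemma R_worlds: "(x, y) \<in> R \<Longrightarrow> x \<in> W \<and> y \<in> W"
  by (simp add: R_def)

lemma trans_R: "trans R"
  unfolding trans_def R_def by blast

lemma wf_R: "wf (R\<inverse>)"
proof -
  have "finite R" by (rule finite_subset[of _ "W \<times> W"]) (use finite_W in \<open>auto simp: R_def\<close>)
  moreover have "acyclic R"
    using trans_R by (auto simp: acyclic_irrefl trancl_id irrefl_def R_def)
  ultimately show ?thesis by (rule finite_acyclic_wf_converse)
qed

lemma holds_disj: "S \<subseteq> \<Phi> \<Longrightarrow> beval v (disj S) \<longleftrightarrow> (\<exists>B\<in>S. beval v B)"
  using finite_subfms by (simp add: beval_disj finite_subset)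

lemma holds_disj_ants: "S \<subseteq> ants \<Longrightarrow> beval v (disj S) \<longleftrightarrow> (\<exists>B\<in>S. beval v B)"
  using finite_antecedents by (simp add: beval_disj finite_subset)

lemma R_holds: "(x, y) \<in> R \<Longrightarrow> g x (\<^bold>\<box> D) \<Longrightarrow> D \<in> boxed \<Longrightarrow> holds y D"
  by (simp add: R_def)

section \<open>Successors witnessing failures\<close>

text \<open>The valuation found by Loeb's axiom need not label a world, but a world agreeing with it
  on the relevant formulas is an equally good successor.\<close>

lemma box_witness:
  assumes x: "x \<in> W" and D: "D \<in> boxed" "\<not> g x (\<^bold>\<box> D)"
  obtains y where "(x, y) \<in> R" "\<not> holds y D"
proof -
  obtain u where u: "canon \<Sigma> u" "\<And>D. g x (\<^bold>\<box> D) \<Longrightarrow> beval u D \<and> u (\<^bold>\<box> D)"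
    "\<not> beval u D" "u (\<^bold>\<box> D)"
    using canon_box_witness[OF canon_g[OF x] D(2)] by blast
  obtain y where y: "y \<in> W" and eq: "\<And>B. B \<in> relevant A\<^sub>0 \<Longrightarrow> holds y B \<longleftrightarrow> beval u B"
    using dense_g[OF u(1)] by blast
  have "holds y E \<longleftrightarrow> beval u E" "g y (\<^bold>\<box> E) \<longleftrightarrow> u (\<^bold>\<box> E)" if "E \<in> boxed" for E
    using eq[of E] eq[of "\<^bold>\<box> E"] that by (auto simp: relevant_def)
  then have "(x, y) \<in> R" "\<not> holds y D"
    using x y u D unfolding R_def by auto
  then show ?thesis by (rule that)
qed

text \<open>The successor is found by applying Loeb to \<open>X = A \<and> \<not>\<Or>T\<close>, where \<open>T\<close> collects the \<open>C\<close> with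
  \<open>C \<rhd> B\<close>: if \<open>\<box>\<not>X\<close> were true, so would be \<open>X \<rhd> B\<close>, and then \<open>A \<rhd> B\<close> by the disjunction axiom.\<close>

lemma rhd_witness:
  assumes x: "x \<in> W" and A: "A \<in> \<Phi> \<union> disj ` Pow \<Phi>" and n: "\<not> g x (A \<^bold>\<rhd> B)"
  obtains y where "(x, y) \<in> R" "holds y A" "\<And>C. C \<in> ants \<Longrightarrow> g x (C \<^bold>\<rhd> B) \<Longrightarrow> \<not> holds y C"
proof -
  define T where "T = {C\<in>ants. g x (C \<^bold>\<rhd> B)}"
  have T: "T \<subseteq> ants" by (auto simp: T_def)
  have "g x (disj T \<^bold>\<rhd> B)"
    by (rule canon_disj_rhd[OF canon_g[OF x]]) (use finite_antecedents in \<open>auto simp: T_def\<close>)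
  then have "\<not> g x (\<^bold>\<box> \<^bold>\<not> (A \<^bold>\<and> \<^bold>\<not> disj T))"
    using canon_rhd_local[OF canon_g[OF x]] n by blast
  moreover have "\<^bold>\<not> (A \<^bold>\<and> \<^bold>\<not> disj T) \<in> boxed"
    using A T by (force simp: box_bodies_def)
  ultimately obtain y where "(x, y) \<in> R" "\<not> holds y (\<^bold>\<not> (A \<^bold>\<and> \<^bold>\<not> disj T))"
    using box_witness[OF x] by blast
  then show ?thesis using that holds_disj_ants[OF T] by (auto simp: T_def)
qed

section \<open>Frame conditions\<close>

text \<open>\<open>J4\<close> by contraposition: if no successor of \<open>x\<close> satisfied
  \<open>disj S\<close>, none would satisfy \<open>C\<close>, although \<open>y\<close>
  does.\<close>

lemma ext_meets_R:
  assumes xy: "(x, y) \<in> R" and C: "C \<in> ants" "holds y C" and S: "S \<subseteq> \<Phi>" and CS: "g x (C \<^bold>\<rhd> disj S)"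
  shows "ext x (disj S) \<inter> R `` {x} \<noteq> {}"
proof -
  have x: "x \<in> W" using xy R_worlds by blast
  have "\<not> g x (\<^bold>\<box> \<^bold>\<not> disj S)"
  proof
    assume "g x (\<^bold>\<box> \<^bold>\<not> disj S)"
    then have "g x (\<^bold>\<box> \<^bold>\<not> C)" by (rule canon_J4[OF canon_g[OF x] CS])
    moreover have "\<^bold>\<not> C \<in> boxed" using C by (simp add: box_bodies_def)
    ultimately have "holds y (\<^bold>\<not> C)" by (rule R_holds[OF xy])
    then show False using C by simp
  qed
  moreover have "\<^bold>\<not> disj S \<in> boxed" using S by (simp add: box_bodies_def)
  ultimately obtain z where "(x, z) \<in> R" "\<not> holds z (\<^bold>\<not> disj S)"
    using box_witness[OF x] by blast
  then show ?thesis using R_worlds by (auto simp: ext_def)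
qed

text \<open>Each clause of \<open>N\<close> forces a successor of \<open>x\<close> into
  \<open>V\<close>. Both the nonemptiness of \<open>V\<close> and the validity of \<open>J4\<close>
  rest on this.\<close>

lemma N_meets_R:
  assumes "(y, V) \<in> N x"
  obtains z where "z \<in> V" "(x, z) \<in> R"
proof -
  have xy: "(x, y) \<in> R" using assms by (simp add: N_def)
  consider C S where "C \<in> ants" "S \<subseteq> \<Phi>" "g x (C \<^bold>\<rhd> disj S)" "holds y C" "ext x (disj S) \<subseteq> V"
    | "y \<in> V" | z where "z \<in> V" "(y, z) \<in> R"
    using assms unfolding N_def by blast
  then show ?thesis
  proof cases
    case 1
    then show ?thesis using ext_meets_R[OF xy 1(1,4,2,3)] that by blast
  next
    case 2
    then show ?thesis using that xy by blast
  next
    case 3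
    then show ?thesis using that transD[OF trans_R xy] by blast
  qed
qed

lemma N_mono:
  assumes "(y, V) \<in> N x" "V \<subseteq> U" "U \<subseteq> W"
  shows "(y, U) \<in> N x"
proof -
  have "ext x D \<subseteq> V \<Longrightarrow> ext x D \<subseteq> U" "y \<in> V \<Longrightarrow> y \<in> U"
    "V \<inter> R `` {y} \<noteq> {} \<Longrightarrow> U \<inter> R `` {y} \<noteq> {}" for D
    using assms(2) by auto
  then show ?thesis using assms(1,3) unfolding N_def mem_Collect_eq prod.case by metis
qed

lemma ILS_frame_M: "ILS_frame M"
proof -
  \<comment> \<open>Without worlds there would be no canonical valuation, and
    \<open>derivesI\<close> would derive \<open>A\<^sub>0\<close>.\<close>
  have "W \<noteq> {}" using derivesI[of \<Sigma> A\<^sub>0] underivable dense_g by blast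
  moreover have "N x \<subseteq> W \<times> (Pow W - {{}})" for x
  proof clarify
    fix y V assume yV: "(y, V) \<in> N x"
    then have "V \<noteq> {}" using N_meets_R by blast
    then show "y \<in> W \<and> V \<in> Pow W - {{}}" using yV R_worlds by (auto simp: N_def)
  qed
  moreover have "R \<subseteq> W \<times> W" using R_worlds by auto
  moreover have "(x, y) \<in> R" if "(y, V) \<in> N x" for x y V
    using that by (simp add: N_def)
  ultimately show ?thesis
    using trans_R wf_R N_mono unfolding ILS_frame_def M_simps by blast
qed

section \<open>Truth lemma\<close>

definition val :: "'w \<Rightarrow> nat \<Rightarrow> bool" where
  "val x n = g x (Var n)"

text \<open>Without \<open>j4p\<close> the extension ranges over all worlds, so by density
  \<open>disj S\<close> implies \<open>B\<close> in every canonical valuation and the rule for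
  consequents applies. With \<open>j4p\<close> the inclusion is known only above \<open>x\<close>;
  it yields a box at \<open>x\<close>, and \<open>J4\<^sub>+\<close> replaces the rule.\<close>

lemma rhd_of_ext_subset:
  assumes x: "x \<in> W" and S: "S \<subseteq> \<Phi>" and B: "B \<in> \<Phi>" and CS: "g x (C \<^bold>\<rhd> disj S)"
    and sub: "\<And>z. z \<in> ext x (disj S) \<Longrightarrow> holds z B"
  shows "g x (C \<^bold>\<rhd> B)"
proof (cases j4p)
  case True
  have "g x (\<^bold>\<box> (disj S \<^bold>\<rightarrow> B))"
  proof (rule ccontr)
    assume n: "\<not> ?thesis"
    \<comment> \<open>Writing \<open>B\<close> as \<open>disj {B}\<close> gives the implication the
      shape listed in \<open>box_bodies\<close>.\<close>
    have "\<not> g x (\<^bold>\<box> \<^bold>\<not> (disj S \<^bold>\<and> \<^bold>\<not> disj {B}))"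
      using canon_box_mono[OF canon_g[OF x], of "\<^bold>\<not> (disj S \<^bold>\<and> \<^bold>\<not> disj {B})" "disj S \<^bold>\<rightarrow> B"] n
      by (auto simp: beval_disj)
    moreover have "\<^bold>\<not> (disj S \<^bold>\<and> \<^bold>\<not> disj {B}) \<in> boxed"
      using S B by (force simp: box_bodies_def antecedents_def)
    ultimately obtain z where z: "(x, z) \<in> R" "\<not> holds z (\<^bold>\<not> (disj S \<^bold>\<and> \<^bold>\<not> disj {B}))"
      using box_witness[OF x] by blast
    then have "z \<in> ext x (disj S)" "\<not> holds z B" using R_worlds by (auto simp: ext_def beval_disj)
    then show False using sub by blast
  qed
  moreover have "beval (g x) (\<^bold>\<box> (disj S \<^bold>\<rightarrow> B) \<^bold>\<rightarrow> (C \<^bold>\<rhd> disj S \<^bold>\<rightarrow> C \<^bold>\<rhd> B))"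
    by (rule canon_ax[OF canon_g[OF x]])
      (use ax_J4p[OF True] in \<open>auto simp: logic_axioms_def J4p_def\<close>)
  ultimately show ?thesis using CS by simp
next
  case False
  have "beval u B" if u\<^sub>0: "canon \<Sigma> u" and u: "beval u (disj S)" for u
  proof -
    obtain z where z: "z \<in> W" and eq: "\<And>D. D \<in> \<Phi> \<Longrightarrow> holds z D \<longleftrightarrow> beval u D"
      using dense_g[OF u\<^sub>0] subfms_relevant by blast
    then have "z \<in> ext x (disj S)"
      using u False S unfolding ext_def mem_Collect_eq holds_disj[OF S] by auto
    then show ?thesis using sub eq B by blast
  qed
  then show ?thesis by (rule canon_R1[OF canon_g[OF x] CS])
qed

text \<open>Forwards, the extension of \<open>B\<close> is itself a suitable set. Backwards, a
  successor \<open>y\<close> critical for \<open>B\<close> defeats every clause of \<open>N\<close>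
  that could supply a set on which \<open>B\<close> holds.\<close>

lemma rhd_forced:
  assumes x: "x \<in> W" and B: "A \<in> \<Phi>" "B \<in> \<Phi>"
    and IH: "\<And>z. z \<in> W \<Longrightarrow> sat M val z A \<longleftrightarrow> holds z A" "\<And>z. z \<in> W \<Longrightarrow> sat M val z B \<longleftrightarrow> holds z B"
  shows "sat M val x (A \<^bold>\<rhd> B) \<longleftrightarrow> g x (A \<^bold>\<rhd> B)"
proof
  assume AB: "g x (A \<^bold>\<rhd> B)"
  have "g x (A \<^bold>\<rhd> disj {B})"
    by (rule canon_R1[OF canon_g[OF x] AB]) (simp add: beval_disj)
  moreover have sub: "ext x (disj {B}) \<subseteq> W" by (auto simp: ext_def)
  ultimately have N: "(y, ext x (disj {B})) \<in> N x" if "(x, y) \<in> R" "holds y A" for y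
    using that B unfolding N_def antecedents_def by blast
  have "sat M val z B" if "z \<in> ext x (disj {B})" for z
    using that IH(2) by (auto simp: ext_def beval_disj)
  moreover have "holds y A" if "(x, y) \<in> R" "sat M val y A" for y
    using that IH(1) R_worlds by blast
  ultimately show "sat M val x (A \<^bold>\<rhd> B)"
    using N sub unfolding sat.simps M_simps by meson
next
  assume sat: "sat M val x (A \<^bold>\<rhd> B)"
  show "g x (A \<^bold>\<rhd> B)"
  proof (rule ccontr)
    assume n: "\<not> ?thesis"
    obtain y where y: "(x, y) \<in> R" "holds y A"
      and crit: "\<And>C. C \<in> ants \<Longrightarrow> g x (C \<^bold>\<rhd> B) \<Longrightarrow> \<not> holds y C"
      using rhd_witness[OF x _ n] B by blast
    obtain V where V: "(y, V) \<in> N x" "\<And>z. z \<in> V \<Longrightarrow> sat M val z B"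
      using sat y IH R_worlds by simp blast
    have VW: "V \<subseteq> W" using V by (auto simp: N_def)
    then have VB: "holds z B" if "z \<in> V" for z using that V IH by blast
    consider C S where "C \<in> ants" "S \<subseteq> \<Phi>" "g x (C \<^bold>\<rhd> disj S)" "holds y C" "ext x (disj S) \<subseteq> V"
      | "j1" "y \<in> V" | z where "j5" "z \<in> V" "(y, z) \<in> R"
      using V(1) unfolding N_def by blast
    then show False
    proof cases
      case 1
      then show False using rhd_of_ext_subset[OF x _ B(2)] VB crit by blast
    next
      case 2
      \<comment> \<open>By \<open>J1\<close>, \<open>B \<rhd> B\<close> is true at \<open>x\<close>,
        so criticality makes \<open>B\<close> false at \<open>y\<close>, which lies in
        \<open>V\<close>.\<close>
      have "g x (\<^bold>\<box> (B \<^bold>\<rightarrow> B))" by (rule canon_nec[OF canon_g[OF x]]) simp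
      moreover have "beval (g x) (\<^bold>\<box> (B \<^bold>\<rightarrow> B) \<^bold>\<rightarrow> B \<^bold>\<rhd> B)"
        by (rule canon_ax[OF canon_g[OF x]])
          (use ax_J1[OF 2(1)] in \<open>auto simp: logic_axioms_def J1_def\<close>)
      ultimately show False using crit[of B] VB[OF 2(2)] B by (simp add: antecedents_def)
    next
      case 3
      \<comment> \<open>By \<open>J5\<close> and criticality, \<open>\<diamond> B\<close> is false
        at \<open>y\<close>, so \<open>B\<close> fails at its successor \<open>z\<close>, which lies
        in \<open>V\<close>.\<close>
      have "beval (g x) (\<^bold>\<diamond> B \<^bold>\<rhd> B)"
        by (rule canon_ax[OF canon_g[OF x]])
          (use ax_J5[OF 3(1)] in \<open>auto simp: logic_axioms_def J5_def\<close>)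
      then have "g y (\<^bold>\<box> \<^bold>\<not> B)" using crit[of "\<^bold>\<diamond> B"] B by (auto simp: antecedents_def)
      then have "holds z (\<^bold>\<not> B)"
        by (rule R_holds[OF 3(3)]) (use B in \<open>simp add: box_bodies_def antecedents_def\<close>)
      then show False using VB[OF 3(2)] by simp
    qed
  qed
qed

lemma truth: "x \<in> W \<Longrightarrow> B \<in> \<Phi> \<Longrightarrow> sat M val x B \<longleftrightarrow> holds x B"
proof (induction B arbitrary: x)
  case (Box B)
  have B: "B \<in> \<Phi>" "B \<in> boxed"
    using Box.prems subfms_trans[of "\<^bold>\<box> B" A\<^sub>0] subfms_self[of B] by (auto simp: box_bodies_def)
  have "g x (\<^bold>\<box> B) \<longleftrightarrow> (\<forall>y. (x, y) \<in> R \<longrightarrow> holds y B)"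
    using box_witness[OF Box.prems(1) B(2)] R_holds[OF _ _ B(2)] by blast
  also have "\<dots> \<longleftrightarrow> (\<forall>y. (x, y) \<in> R \<longrightarrow> sat M val y B)"
    using Box.IH[OF _ B(1)] R_worlds by blast
  finally show ?case by simp
next
  case (Rhd A B)
  have "A \<in> \<Phi>" "B \<in> \<Phi>"
    using Rhd.prems subfms_trans[of "A \<^bold>\<rhd> B" A\<^sub>0] subfms_self[of A] subfms_self[of B]
    by auto
  then show ?case using rhd_forced[OF Rhd.prems(1)] Rhd.IH by simp
next
  case (Neg B)
  then show ?case using subfms_trans[of "\<^bold>\<not> B" A\<^sub>0] subfms_self[of B] by auto
next
  case (Con A B)
  then show ?case using subfms_trans[of "A \<^bold>\<and> B" A\<^sub>0] subfms_self[of A] subfms_self[of B]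
    by auto
next
  case (Dis A B)
  then show ?case using subfms_trans[of "A \<^bold>\<or> B" A\<^sub>0] subfms_self[of A] subfms_self[of B]
    by auto
next
  case (Imp A B)
  then show ?case using subfms_trans[of "A \<^bold>\<rightarrow> B" A\<^sub>0] subfms_self[of A] subfms_self[of B]
    by auto
qed (auto simp: val_def)

lemma refutes: "\<not> M \<Turnstile> A\<^sub>0"
proof -
  obtain v where "canon \<Sigma> v" "\<not> beval v A\<^sub>0" using underivable derivesI by blast
  moreover have "A\<^sub>0 \<in> \<Phi>" by (rule subfms_self)
  ultimately obtain x where "x \<in> W" "\<not> holds x A\<^sub>0" using dense_g subfms_relevant by blast
  then show ?thesis using truth \<open>A\<^sub>0 \<in> \<Phi>\<close> by (auto simp: valid_def)
qed

section \<open>Validity of the added schemata\<close>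

lemma M_J4:
  assumes "B \<in> J4"
  shows "M \<Turnstile> B"
proof -
  have "\<exists>z. (x, z) \<in> R \<and> sat M v z C"
    if AC: "sat M v x (A \<^bold>\<rhd> C)" and y: "(x, y) \<in> R" "sat M v y A" for v x y A C
  proof -
    obtain V where V: "(y, V) \<in> N x" "\<forall>z\<in>V. sat M v z C" using AC y by auto
    then show ?thesis using N_meets_R by blast
  qed
  then show ?thesis using assms unfolding J4_def valid_def by fastforce
qed

lemma M_J1:
  assumes j1 "B \<in> J1"
  shows "M \<Turnstile> B"
proof -
  have "\<exists>V\<subseteq>W. (y, V) \<in> N x \<and> (\<forall>z\<in>V. sat M v z C)"
    if "(x, y) \<in> R" "sat M v y C" for v x y C
    using that R_worlds[of x y] assms(1)
    unfolding N_def by (intro exI[of _ "{y}"]) auto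
  then show ?thesis using assms(2) unfolding J1_def valid_def by fastforce
qed

lemma M_J5:
  assumes j5 "B \<in> J5"
  shows "M \<Turnstile> B"
proof -
  have "\<exists>V\<subseteq>W. (y, V) \<in> N x \<and> (\<forall>w\<in>V. sat M v w C)"
    if "(x, y) \<in> R" "(y, z) \<in> R" "sat M v z C" for v x y z C
    using that R_worlds[of y z] assms(1)
    unfolding N_def by (intro exI[of _ "{z}"]) auto
  then show ?thesis using assms(2) unfolding J5_def valid_def by fastforce
qed

lemma M_J4p:
  assumes "j4p" "\<not> j1" "\<not> j5" "B \<in> J4\<^sub>+"
  shows "M \<Turnstile> B"
proof -
  \<comment> \<open>Under \<open>j4p\<close> extensions consist of successors of \<open>x\<close>,
    so \<open>V\<close> may be cut down to these, where the boxed implication applies.\<close>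
  have N: "(y, V \<inter> R `` {x}) \<in> N x" if "(y, V) \<in> N x" for x y V
  proof -
    have "ext x D \<subseteq> R `` {x}" for D using assms(1) unfolding ext_def by auto
    then show ?thesis using that assms unfolding N_def by blast
  qed
  have "\<exists>V\<subseteq>W. (y, V) \<in> N x \<and> (\<forall>z\<in>V. sat M v z D)"
    if y: "(x, y) \<in> R" "sat M v y A" and AC: "sat M v x (A \<^bold>\<rhd> C)"
      and CD: "sat M v x (\<^bold>\<box> (C \<^bold>\<rightarrow> D))" for v x y A C D
  proof -
    obtain V where V: "V \<subseteq> W" "(y, V) \<in> N x" "\<forall>z\<in>V. sat M v z C"
      using AC y by auto
    then show ?thesis
      using N[OF V(2)] CD by (intro exI[of _ "V \<inter> R `` {x}"]) auto
  qed
  then show ?thesis using assms(4) unfolding J4p_def valid_def by fastforce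
qed

text \<open>The union runs only over successors of \<open>x\<close> because \<open>V\<close> may
  contain other worlds, about which a formula \<open>C \<rhd> D\<close> true at \<open>x\<close>
  says nothing.\<close>

lemma N_trans:
  assumes J2: "J2 \<subseteq> \<Sigma>" and no: "\<not> j1" "\<not> j5" and yV: "(y, V) \<in> N x"
    and U: "\<And>z. z \<in> V \<Longrightarrow> (x, z) \<in> R \<Longrightarrow> (z, U z) \<in> N x"
  shows "(y, \<Union>z \<in> V \<inter> R `` {x}. U z) \<in> N x"
proof -
  have xy: "(x, y) \<in> R" and VW: "V \<subseteq> W" using yV by (auto simp: N_def)
  then have x: "x \<in> W" using R_worlds by blast
  obtain C S where C: "C \<in> ants" "holds y C" and S: "S \<subseteq> \<Phi>" "g x (C \<^bold>\<rhd> disj S)" "ext x (disj S) \<subseteq> V"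
    using yV no unfolding N_def by blast
  have "\<exists>C'\<in>ants. \<exists>S'\<subseteq>\<Phi>. g x (C' \<^bold>\<rhd> disj S') \<and> holds z C' \<and> ext x (disj S') \<subseteq> U z"
    if "z \<in> V" "(x, z) \<in> R" for z
    using U[OF that] no unfolding N_def by blast
  then obtain C' S' where C': "\<And>z. z \<in> V \<Longrightarrow> (x, z) \<in> R \<Longrightarrow> C' z \<in> ants \<and> holds z (C' z)"
    and S': "\<And>z. z \<in> V \<Longrightarrow> (x, z) \<in> R \<Longrightarrow>
      S' z \<subseteq> \<Phi> \<and> g x (C' z \<^bold>\<rhd> disj (S' z)) \<and> ext x (disj (S' z)) \<subseteq> U z"
    by metis
  define T where "T = (\<Union>z \<in> V \<inter> R `` {x}. S' z)"
  have T: "T \<subseteq> \<Phi>" using S' by (auto simp: T_def)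
  \<comment> \<open>A critical counterexample \<open>z\<close> would lie in \<open>V\<close>; then
    \<open>C' z\<close> is true at \<open>z\<close> and related at \<open>x\<close> to
    \<open>disj (S' z)\<close>, hence to the weaker \<open>disj T\<close>, against
    criticality.\<close>
  have "g x (disj S \<^bold>\<rhd> disj T)"
  proof (rule ccontr)
    assume "\<not> ?thesis"
    then obtain z where z: "(x, z) \<in> R" "holds z (disj S)"
      and crit: "\<And>C. C \<in> ants \<Longrightarrow> g x (C \<^bold>\<rhd> disj T) \<Longrightarrow> \<not> holds z C"
      using rhd_witness[OF x, of "disj S" "disj T"] S(1) by blast
    have zV: "z \<in> V" using z S(3) R_worlds by (auto simp: ext_def)
    have "g x (C' z \<^bold>\<rhd> disj (S' z))" using S' zV z by blast
    then have "g x (C' z \<^bold>\<rhd> disj T)"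
    proof (rule canon_R1[OF canon_g[OF x]])
      fix u assume "beval u (disj (S' z))"
      then show "beval u (disj T)"
        using holds_disj[OF T] holds_disj[of "S' z"] S'[OF zV z(1)] zV z(1) by (auto simp: T_def)
    qed
    then show False using crit C' zV z by blast
  qed
  moreover have "beval (g x) ((C \<^bold>\<rhd> disj S) \<^bold>\<and> (disj S \<^bold>\<rhd> disj T) \<^bold>\<rightarrow> C \<^bold>\<rhd> disj T)"
    by (rule canon_ax[OF canon_g[OF x]]) (use J2 in \<open>auto simp: logic_axioms_def J2_def\<close>)
  ultimately have "g x (C \<^bold>\<rhd> disj T)" using S by simp
  moreover have "ext x (disj T) \<subseteq> (\<Union>z \<in> V \<inter> R `` {x}. U z)"
  proof
    fix w assume w: "w \<in> ext x (disj T)"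
    then obtain D where "D \<in> T" "holds w D" using holds_disj[OF T] by (auto simp: ext_def)
    then obtain z where z: "z \<in> V" "(x, z) \<in> R" "D \<in> S' z" by (auto simp: T_def)
    then have "w \<in> ext x (disj (S' z))"
      using w \<open>holds w D\<close> holds_disj[of "S' z"] S' by (auto simp: ext_def)
    then show "w \<in> (\<Union>z \<in> V \<inter> R `` {x}. U z)" using z S' by blast
  qed
  moreover have "(\<Union>z \<in> V \<inter> R `` {x}. U z) \<subseteq> W" using U by (auto simp: N_def)
  ultimately show ?thesis using xy C T unfolding N_def by blast
qed

lemma M_J2:
  assumes J2: "J2 \<subseteq> \<Sigma>" and no: "\<not> j1" "\<not> j5" and "B \<in> J2"
  shows "M \<Turnstile> B"
proof -
  have "\<exists>V\<subseteq>W. (y, V) \<in> N x \<and> (\<forall>z\<in>V. sat M v z D)"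
    if xy: "(x, y) \<in> R" "sat M v y A" and AC: "sat M v x (A \<^bold>\<rhd> C)" and CD: "sat M v x (C \<^bold>\<rhd> D)"
    for v x y A C D
  proof -
    obtain V where V: "(y, V) \<in> N x" "\<And>z. z \<in> V \<Longrightarrow> sat M v z C"
      using AC xy by auto
    then have "\<exists>U. (z, U) \<in> N x \<and> (\<forall>w\<in>U. sat M v w D)" if "z \<in> V" "(x, z) \<in> R" for z
      using that CD by auto
    then obtain U where U: "\<And>z. z \<in> V \<Longrightarrow> (x, z) \<in> R \<Longrightarrow> (z, U z) \<in> N x \<and> (\<forall>w\<in>U z. sat M v w D)"
      by metis
    then have N: "(y, \<Union>z \<in> V \<inter> R `` {x}. U z) \<in> N x"
      using N_trans[OF J2 no V(1), of U] by blast
    then have "(\<Union>z \<in> V \<inter> R `` {x}. U z) \<subseteq> W" by (simp add: N_def)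
    moreover have "\<forall>w \<in> (\<Union>z \<in> V \<inter> R `` {x}. U z). sat M v w D" using U by blast
    ultimately show ?thesis using N by (intro exI conjI)
  qed
  then show ?thesis using assms(4) unfolding J2_def valid_def by fastforce
qed

end

section \<open>Soundness\<close>

text \<open>Satisfaction at a point is itself a Boolean evaluation, hence tautologies hold at every
  point.\<close>

lemma sat_beval: "sat F v x A \<longleftrightarrow> beval (sat F v x) A"
  by (induction A) auto

lemma IL_minus_valid:
  assumes F: "ILS_frame F" and B: "B \<in> IL_minus_axioms"
  shows "F \<Turnstile> B"
proof -
  have acc: "trans (acc F)" "wf ((acc F)\<inverse>)" and
    N: "\<And>x y V. x \<in> worlds F \<Longrightarrow> (y, V) \<in> intp F x \<Longrightarrow> V \<noteq> {} \<and> (x, y) \<in> acc F"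
    using F by (auto simp: ILS_frame_def)
  \<comment> \<open>Induction along the converse of accessibility; transitivity keeps the successors
    of \<open>y\<close> above \<open>x\<close>.\<close>
  have Loeb: "sat F v y A" if "\<And>y. (x, y) \<in> acc F \<Longrightarrow> sat F v y (\<^bold>\<box> A \<^bold>\<rightarrow> A)" "(x, y) \<in> acc F"
    for v x y A
    using that(2)
  proof (induction y rule: wf_induct_rule[OF acc(2)])
    case (1 y)
    then have "sat F v y (\<^bold>\<box> A)" using transD[OF acc(1)] by auto
    then show ?case using that(1)[OF 1(2)] by simp
  qed
  \<comment> \<open>Sets in the relations are nonempty, so none of them satisfies falsum
    throughout.\<close>
  have J6: "sat F v x (\<^bold>\<box> A) \<longleftrightarrow> sat F v x ((\<^bold>\<not> A) \<^bold>\<rhd> \<^bold>\<bottom>)" if "x \<in> worlds F" for v x A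
    using N[OF that] by fastforce
  have "sat F v x A" if "tautology A" for v x A
    using that sat_beval[of F v x A] unfolding tautology_def by blast
  then have taut: "F \<Turnstile> A" if "tautology A" for A
    using that by (simp add: valid_def)
  show ?thesis
    using B unfolding IL_minus_axioms_def
  proof (elim UnE)
    assume "B \<in> {\<^bold>\<box> (\<^bold>\<box> A \<^bold>\<rightarrow> A) \<^bold>\<rightarrow> \<^bold>\<box> A | A. True}"
    then obtain A where B: "B = \<^bold>\<box> (\<^bold>\<box> A \<^bold>\<rightarrow> A) \<^bold>\<rightarrow> \<^bold>\<box> A" by blast
    have "sat F v x (\<^bold>\<box> A)" if "sat F v x (\<^bold>\<box> (\<^bold>\<box> A \<^bold>\<rightarrow> A))" for v x
      using that Loeb[of x v A] unfolding sat.simps(8)[of F v x] by blast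
    then show ?thesis by (simp only: B valid_def sat.simps(7)) blast
  next
    assume "B \<in> {\<^bold>\<box> A \<^bold>\<leftrightarrow> (\<^bold>\<not> A) \<^bold>\<rhd> \<^bold>\<bottom> | A. True}"
    then show ?thesis using J6 by (auto simp: valid_def simp del: sat.simps(8,9))
  next
    assume "B \<in> {A. tautology A}"
    then show ?thesis using taut by simp
  qed (auto simp: valid_def)
qed

lemma soundness:
  assumes "IL\<^sup>-(\<Sigma>) \<turnstile> A" and F: "frame_for \<Sigma> F"
  shows "F \<Turnstile> A"
proof -
  have acc: "\<And>x y. (x, y) \<in> acc F \<Longrightarrow> y \<in> worlds F"
    using F by (auto simp: frame_for_def ILS_frame_def)
  show ?thesis
    using assms(1)
  proof induction
    case (ax A)
    then show ?case using F by (simp add: frame_for_def)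
  next
    case (R1 A B C)
    then have "sat F v z A \<Longrightarrow> sat F v z B" if "z \<in> worlds F" for v z
      using that by (simp add: valid_def)
    then show ?case unfolding valid_def sat.simps by (meson subsetD)
  next
    case (R2 A B C)
    then have "sat F v z A \<Longrightarrow> sat F v z B" if "z \<in> worlds F" for v z
      using that by (simp add: valid_def)
    then show ?case using acc unfolding valid_def sat.simps by meson
  qed (use acc in \<open>auto simp: valid_def\<close>)
qed

section \<open>Finite countermodels for the six logics\<close>

text \<open>\<open>J2\<close> yields the same with falsum as its last formula, since
  \<open>B \<rhd> \<bottom>\<close> amounts to \<open>\<box> \<not> B\<close>.\<close>

lemma canon_J4:
  assumes v: "canon \<Sigma> v" and \<Sigma>: "J4 \<subseteq> \<Sigma> \<or> J2 \<subseteq> \<Sigma>"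
    and AB: "v (A \<^bold>\<rhd> B)" and B: "v (\<^bold>\<box> \<^bold>\<not> B)"
  shows "v (\<^bold>\<box> \<^bold>\<not> A)"
  using \<Sigma>
proof
  assume "J4 \<subseteq> \<Sigma>"
  then have "beval v (A \<^bold>\<rhd> B \<^bold>\<rightarrow> (\<^bold>\<diamond> A \<^bold>\<rightarrow> \<^bold>\<diamond> B))"
    by (intro canon_ax[OF v]) (auto simp: logic_axioms_def J4_def)
  then show ?thesis using AB B by auto
next
  assume "J2 \<subseteq> \<Sigma>"
  then have "beval v ((A \<^bold>\<rhd> B) \<^bold>\<and> (B \<^bold>\<rhd> \<^bold>\<bottom>) \<^bold>\<rightarrow> A \<^bold>\<rhd> \<^bold>\<bottom>)"
    by (intro canon_ax[OF v]) (auto simp: logic_axioms_def J2_def)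
  then show ?thesis using AB B by (simp add: canon_rhd_bot[OF v])
qed

text \<open>Valuations are classified by their finitely many traces on \<open>\<Psi>\<close>; an
  infinite type has enough points to name each trace, and \<open>g\<close> picks a
  representative.\<close>

lemma finite_dense_canon:
  assumes "finite \<Psi>" and inf: "infinite (UNIV :: 'w set)"
  obtains W :: "'w set" and g where "finite W" "\<And>x. x \<in> W \<Longrightarrow> canon \<Sigma> (g x)"
    "\<And>v. canon \<Sigma> v \<Longrightarrow> \<exists>x\<in>W. \<forall>B\<in>\<Psi>. beval (g x) B \<longleftrightarrow> beval v B"
proof -
  define trace where "trace v = {B\<in>\<Psi>. beval v B}" for v
  define \<T> where "\<T> = trace ` {v. canon \<Sigma> v}"
  have "finite \<T>" by (rule finite_subset[of _ "Pow \<Psi>"]) (use assms(1) in \<open>auto simp: \<T>_def trace_def\<close>)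
  moreover obtain W :: "'w set" where W: "finite W" "card W = card \<T>"
    using infinite_arbitrarily_large[OF inf] by blast
  ultimately obtain h where h: "bij_betw h W \<T>" using finite_same_card_bij by blast
  have "\<forall>x\<in>W. \<exists>v. canon \<Sigma> v \<and> trace v = h x" using bij_betwE[OF h] by (fastforce simp: \<T>_def)
  then obtain g where g: "\<And>x. x \<in> W \<Longrightarrow> canon \<Sigma> (g x) \<and> trace (g x) = h x" by metis
  show ?thesis
  proof (rule that[OF W(1)])
    show "canon \<Sigma> (g x)" if "x \<in> W" for x using g that by blast
    fix v assume "canon \<Sigma> v"
    then have "trace v \<in> h ` W" using h by (auto simp: bij_betw_def \<T>_def)
    then obtain x where "x \<in> W" "trace (g x) = trace v" using g by auto
    then show "\<exists>x\<in>W. \<forall>B\<in>\<Psi>. beval (g x) B \<longleftrightarrow> beval v B" by (auto simp: trace_def)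
  qed
qed

text \<open>The flags are chosen to match the schemata present; the last assumption says that each
  of them is covered by a validity result for the canonical frame.\<close>

lemma finite_countermodel:
  assumes inf: "infinite (UNIV :: 'w set)" and A: "\<not> (IL\<^sup>-(\<Sigma>) \<turnstile> A)"
    and J4: "J4 \<subseteq> \<Sigma> \<or> J2 \<subseteq> \<Sigma>"
    and J1: "j1 \<Longrightarrow> J1 \<subseteq> \<Sigma>" and J5: "j5 \<Longrightarrow> J5 \<subseteq> \<Sigma>" and J4p: "j4p \<Longrightarrow> J4\<^sub>+ \<subseteq> \<Sigma>"
    and \<Sigma>: "\<And>B. B \<in> \<Sigma> \<Longrightarrow> B \<in> J4 \<or> j1 \<and> B \<in> J1 \<or> j5 \<and> B \<in> J5 \<or>
      \<not> j1 \<and> \<not> j5 \<and> (j4p \<and> B \<in> J4\<^sub>+ \<or> J2 \<subseteq> \<Sigma> \<and> B \<in> J2)"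
  shows "\<exists>F :: 'w frame. frame_for \<Sigma> F \<and> finite (worlds F) \<and> \<not> F \<Turnstile> A"
proof -
  obtain W :: "'w set" and g where W: "finite W" "\<And>x. x \<in> W \<Longrightarrow> canon \<Sigma> (g x)"
    "\<And>v. canon \<Sigma> v \<Longrightarrow> \<exists>x\<in>W. \<forall>B\<in>relevant A. beval (g x) B \<longleftrightarrow> beval v B"
    using finite_dense_canon[OF finite_relevant inf] by metis
  interpret canonical_model \<Sigma> j1 j5 j4p A W g
    by unfold_locales (use A J1 J5 J4p W canon_J4[OF _ J4] in simp_all)
  have "M \<Turnstile> B" if "B \<in> \<Sigma>" for B
    using \<Sigma>[OF that] M_J1 M_J2 M_J4 M_J4p M_J5 by blast
  then have "frame_for \<Sigma> M"
    using ILS_frame_M IL_minus_valid[OF ILS_frame_M] by (auto simp: frame_for_def logic_axioms_def)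
  then show ?thesis using refutes finite_W by (intro exI[of _ M]) simp
qed

theorem theorem7p1:
  fixes \<Sigma> :: "fm set" and A :: fm
  assumes univ: "infinite (UNIV :: 'w set)"
    and L: "\<Sigma> \<in> {J4, J1 \<union> J4, J4 \<union> J5, J1 \<union> J4 \<union> J5, J2, J2 \<union> J4\<^sub>+}"
  shows "(IL\<^sup>-(\<Sigma>) \<turnstile> A \<longleftrightarrow> (\<forall>F :: 'w frame. frame_for \<Sigma> F \<longrightarrow> F \<Turnstile> A)) \<and>
    (IL\<^sup>-(\<Sigma>) \<turnstile> A \<longleftrightarrow> (\<forall>F :: 'w frame. frame_for \<Sigma> F \<and> finite (worlds F) \<longrightarrow> F \<Turnstile> A))"
proof -
  \<comment> \<open>One finite countermodel refutes both frame conditions at once; soundness gives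
    the converse directions.\<close>
  have "\<exists>F :: 'w frame. frame_for \<Sigma> F \<and> finite (worlds F) \<and> \<not> F \<Turnstile> A" if A: "\<not> (IL\<^sup>-(\<Sigma>) \<turnstile> A)"
  proof -
    consider "\<Sigma> = J4" | "\<Sigma> = J1 \<union> J4" | "\<Sigma> = J4 \<union> J5" | "\<Sigma> = J1 \<union> J4 \<union> J5"
      | "\<Sigma> = J2" | "\<Sigma> = J2 \<union> J4\<^sub>+" using L by blast
    then show ?thesis
    proof cases
      \<comment> \<open>The three truth values instantiate \<open>j1\<close>, \<open>j5\<close> and
        \<open>j4p\<close>, in this order.\<close>
      case 1 show ?thesis by (rule finite_countermodel[OF univ A, of False False False]) (use 1 in auto)
    next
      case 2 show ?thesis by (rule finite_countermodel[OF univ A, of True False False]) (use 2 in auto)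
    next
      case 3 show ?thesis by (rule finite_countermodel[OF univ A, of False True False]) (use 3 in auto)
    next
      case 4 show ?thesis by (rule finite_countermodel[OF univ A, of True True False]) (use 4 in auto)
    next
      case 5 show ?thesis by (rule finite_countermodel[OF univ A, of False False False]) (use 5 in auto)
    next
      case 6 show ?thesis by (rule finite_countermodel[OF univ A, of False False True]) (use 6 in auto)
    qed
  qed
  then show ?thesis using soundness by blast
qed

end
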